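(* Let $\omega_i=(\alpha_i,\varepsilon_{i1},\mu_i,\eta_{i1})$. Suppose that $P(\nu_i>c)\in(0,1)$ for some $c\in\mathbb{R}$ and that $\nu_i$ is independent of $(\alpha_i,\varepsilon_{i1},\varepsilon_{i2},\mu_i,\eta_{i1},\eta_{i2})$. Suppose further that either $P(E[\dot Y_{i2}(0)-\dot Y_{i1}(0)\mid\omega_i]>0)<1$ or $P(E[\dot Y_{i2}(0)-\dot Y_{i1}(0)\mid\omega_i]<0)<1$. Then parallel trends, $E[Y_{i2}(0)-Y_{i1}(0)\mid G_i=1]=E[Y_{i2}(0)-Y_{i1}(0)\mid G_i=0]$, holds for all $g\in\mathcal{G}_\omega$ such that $G_i=g(\omega_i,\nu_i)$ satisfies $P(G_i=1)\in(0,1)$ if and only if $E[\dot Y_{i2}(0)\mid\alpha_i,\varepsilon_{i1},\mu_i,\eta_{i1}]=\dot Y_{i1}(0)$ almost surely.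
   Context: Units are indexed by $i$ (i.i.d. across $i$; all statements are about a generic unit $i$) and periods by $t\in\{1,2\}$. The unobservables $\alpha_i,\varepsilon_{i1},\varepsilon_{i2}$ are finite-dimensional random vectors, $\mu_i,\eta_{i1},\eta_{i2}$ are additional random vectors, and $\nu_i$ is a scalar random variable. The untreated potential outcomes are real-valued and given by $Y_{it}(0)=\xi_t(\alpha_i,\varepsilon_{it})$, $t=1,2$, for arbitrary (measurable) functions $\xi_t$. All relevant moments are assumed to exist (in particular $E|Y_{it}(0)|<\infty$). Notation: $\dot Y_{it}(0)=Y_{it}(0)-E[Y_{it}(0)]$. Let $\mathcal{O}$ and $\mathcal{V}$ be the supports of $\omega_i$ and $\nu_i$; $\mathcal{G}_\omega$ is the class of all (measurable) functions $g:\mathcal{O}\times\mathcal{V}\to\{0,1\}$, called selection mechanisms, and the treatment-group indicator generated by $g$ is $G_i=g(\omega_i,\nu_i)$. The distribution of the unobservables is held fixed as $g$ varies. *)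

theory Defs
  imports "HOL-Probability.Probability"
begin

text \<open>Topological support of the law of the random vector \<open>X\<close>.\<close>

definition rv_support :: "'w measure \<Rightarrow> ('w \<Rightarrow> 'b::topological_space) \<Rightarrow> 'b set" where
  "rv_support M X =
     {x. \<forall>U. open U \<and> x \<in> U \<longrightarrow> 0 < measure M {w \<in> space M. X w \<in> U}}"

definition rv_sigma :: "'w measure \<Rightarrow> ('w \<Rightarrow> 'b::topological_space) \<Rightarrow> 'w measure" where
  "rv_sigma M X = vimage_algebra (space M) X borel"

definition demeaned :: "'w measure \<Rightarrow> ('w \<Rightarrow> real) \<Rightarrow> 'w \<Rightarrow> real" where
  "demeaned M X = (\<lambda>w. X w - (\<integral>v. X v \<partial>M))"

text \<open>\<open>E[X | A]\<close> for an event \<open>A\<close>; meaningful when \<open>A\<close> has positive probability.\<close>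

definition expectation_given_event :: "'w measure \<Rightarrow> ('w \<Rightarrow> real) \<Rightarrow> 'w set \<Rightarrow> real" where
  "expectation_given_event M X A = (\<integral>w\<in>A. X w \<partial>M) / measure M A"

text \<open>Measurable functions from (support of \<open>\<omega>\<close>) \<open>\<times>\<close> (support of \<open>\<nu>\<close>) to \<open>{0, 1}\<close>. Since HOL
  functions are total, they are represented extensionally, i.e. with the fixed dummy value
  \<open>undefined\<close> off the product of the supports, a closed set that contains
  \<open>(\<omega>, \<nu>)\<close> almost surely.\<close>

definition selection_mechanisms ::
  "'w measure \<Rightarrow> ('w \<Rightarrow> 'b::euclidean_space) \<Rightarrow> ('w \<Rightarrow> real) \<Rightarrow> ('b \<times> real \<Rightarrow> nat) set" where
  "selection_mechanisms M \<omega> \<nu> =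
     extensional (rv_support M \<omega> \<times> rv_support M \<nu>) \<inter>
     measurable (restrict_space borel (rv_support M \<omega> \<times> rv_support M \<nu>)) (count_space {0, 1})"

definition parallel_trends ::
  "'w measure \<Rightarrow> ('w \<Rightarrow> real) \<Rightarrow> ('w \<Rightarrow> real) \<Rightarrow> ('w \<Rightarrow> nat) \<Rightarrow> bool" where
  "parallel_trends M Y1 Y2 G \<longleftrightarrow>
     expectation_given_event M (\<lambda>w. Y2 w - Y1 w) {w \<in> space M. G w = 1} =
     expectation_given_event M (\<lambda>w. Y2 w - Y1 w) {w \<in> space M. G w = 0}"

end

theory Submission
  imports Defs
begin

text \<open>Let \<open>D\<close> be the demeaned change \<open>Y2 - Y1\<close>. Parallel trends for a group \<open>G\<close> of probability
  strictly between 0 and 1 says that \<open>D\<close> integrates to 0 over \<open>{G = 1}\<close>. By Fubini, the integral of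
  \<open>D\<close> over \<open>{(\<omega>, \<nu>) \<in> S}\<close> is the average over \<open>\<nu>\<close> of its integrals over \<open>{\<omega> \<in> S\<^sub>v}\<close>, where \<open>S\<^sub>v\<close> are
  the sections of \<open>S\<close>. If \<open>E[D | \<omega>] = 0\<close>, all of these vanish. Conversely, the mechanism that selects
  \<open>{\<omega> \<in> B, \<nu> > c}\<close> yields \<open>P(\<nu> > c) E[D; \<omega> \<in> B] = 0\<close>, and its probability is automatically below 1.\<close>

section \<open>Supports of random vectors and selection mechanisms\<close>

lemma closed_rv_support: "closed (rv_support M X)"
proof -
  have "\<exists>T. open T \<and> x \<in> T \<and> T \<subseteq> - rv_support M X" if "x \<in> - rv_support M X" for x
    using that unfolding rv_support_def by blast
  then have "open (- rv_support M X)"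
    by (subst open_subopen) blast
  then show ?thesis
    by (simp add: closed_def)
qed

text \<open>A point lying in no null member of a countable basis belongs to the support, because
  each of its open neighbourhoods contains a basis set around it, which has positive measure. Only
  countably many null events have to be avoided, so this happens almost surely.\<close>

lemma (in finite_measure) AE_in_rv_support:
  fixes X :: "'a \<Rightarrow> 'b::second_countable_topology"
  assumes X [measurable]: "X \<in> borel_measurable M"
  shows "AE w in M. X w \<in> rv_support M X"
proof -
  obtain B :: "'b set set" where B: "countable B" "topological_basis B"
    using ex_countable_basis by auto
  define N where "N = {b \<in> B. measure M {w \<in> space M. X w \<in> b} = 0}"
  have "AE w in M. X w \<notin> b" if "b \<in> N" for b
  proof -
    have [measurable]: "b \<in> sets borel"
      using that B(2) by (auto simp: N_def dest: topological_basis_open)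
    have "{w \<in> space M. X w \<in> b} \<in> null_sets M"
      using that by (auto simp: N_def emeasure_eq_measure intro!: null_setsI)
    then show ?thesis
      by (rule AE_I') auto
  qed
  moreover have "countable N"
    using B(1) by (auto simp: N_def intro: countable_subset[of _ B])
  ultimately have "AE w in M. \<forall>b\<in>N. X w \<notin> b"
    by (simp add: AE_ball_countable)
  then show ?thesis
  proof (rule AE_mp, intro AE_I2 impI)
    fix w assume w: "w \<in> space M" "\<forall>b\<in>N. X w \<notin> b"
    show "X w \<in> rv_support M X"
      unfolding rv_support_def
    proof (intro CollectI allI impI)
      fix U assume U: "open U \<and> X w \<in> U"
      then obtain b where b: "b \<in> B" "X w \<in> b" "b \<subseteq> U"
        using B(2) topological_basisE by metis
      have [measurable]: "U \<in> sets borel"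
        using U by auto
      have "measure M {w \<in> space M. X w \<in> b} > 0"
        using w(2) b by (auto simp: N_def zero_less_measure_iff)
      also have "measure M {w \<in> space M. X w \<in> b} \<le> measure M {w \<in> space M. X w \<in> U}"
        using b by (intro finite_measure_mono) auto
      finally show "0 < measure M {w \<in> space M. X w \<in> U}" .
    qed
  qed
qed

text \<open>Off the product of the supports, \<open>g\<close> is the constant
  \<open>undefined\<close>; the product is closed, hence Borel, so gluing the two pieces preserves
  measurability. This makes events such as \<open>{g = 1}\<close> measurable on the whole
  space.\<close>

lemma selection_mechanism_measurable:
  assumes "g \<in> selection_mechanisms M \<omega> \<nu>"
  shows "g \<in> measurable borel (count_space UNIV)"
proof -
  define K where "K = rv_support M \<omega> \<times> rv_support M \<nu>"
  have K: "K \<in> sets borel"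
    unfolding K_def by (intro borel_closed closed_Times closed_rv_support)
  have "g \<in> measurable (restrict_space borel K) (count_space {0, 1})"
    using assms by (auto simp: selection_mechanisms_def K_def)
  then have "g \<in> measurable (restrict_space borel K) (count_space UNIV)"
    by (rule measurable_compose) simp
  then have "(\<lambda>x. if x \<in> K then g x else undefined) \<in> measurable borel (count_space UNIV)"
    using K by (subst (asm) measurable_restrict_space_iff[where c=undefined]) auto
  moreover have "(\<lambda>x. if x \<in> K then g x else undefined) = g"
    using assms by (auto simp: selection_mechanisms_def K_def extensional_def)
  ultimately show ?thesis
    by simp
qed

text \<open>Supplies the test mechanisms for the converse direction: any Borel set of values of
  \<open>(\<omega>, \<nu>)\<close> can be made the treated group. The \<open>restrict\<close>
  secures membership in \<open>extensional\<close>.\<close>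

lemma restrict_indicator_selection_mechanism:
  fixes \<omega> :: "'w \<Rightarrow> 'b::euclidean_space"
  assumes "S \<in> sets borel"
  shows "restrict (indicator S) (rv_support M \<omega> \<times> rv_support M \<nu>) \<in> selection_mechanisms M \<omega> \<nu>"
proof -
  have [measurable]: "S \<in> sets borel" by fact
  let ?K = "rv_support M \<omega> \<times> rv_support M \<nu>"
  have [measurable]: "(indicator S :: _ \<Rightarrow> nat) \<in> measurable borel (count_space {0, 1})"
    unfolding indicator_def by measurable
  have "(indicator S :: _ \<Rightarrow> nat) \<in> measurable (restrict_space borel ?K) (count_space {0, 1})"
    by (intro measurable_restrict_space1) measurable
  then have "(restrict (indicator S) ?K :: _ \<Rightarrow> nat) \<in> measurable (restrict_space borel ?K) (count_space {0, 1})"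
    by (subst measurable_cong[where g="indicator S"]) (auto simp: space_restrict_space)
  then show ?thesis
    by (simp add: selection_mechanisms_def)
qed

section \<open>Parallel trends and independence in terms of integrals over events\<close>

lemma (in prob_space) expectation_given_event_eq_iff:
  assumes X: "integrable M X" and A: "A \<in> events" and B: "B \<in> events"
    and disj: "A \<inter> B = {}" and ae: "AE w in M. w \<in> A \<union> B"
    and pA: "prob A \<in> {0<..<1}"
  shows "expectation_given_event M X A = expectation_given_event M X B \<longleftrightarrow>
    (\<integral>w\<in>A. (X w - expectation X) \<partial>M) = 0"
proof -
  note [measurable] = A B
  have AX: "set_integrable M A X" and BX: "set_integrable M B X"
    unfolding set_integrable_def by (intro integrable_mult_indicator X A B)+
  have "prob (A \<union> B) = 1"
    using ae A B by (intro prob_eq_1[THEN iffD2]) auto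
  then have pB: "prob B = 1 - prob A"
    using finite_measure_Union[OF A B disj] by simp
  have "(\<integral>w\<in>A. X w \<partial>M) + (\<integral>w\<in>B. X w \<partial>M) = (\<integral>w\<in>A \<union> B. X w \<partial>M)"
    using set_integral_Un[OF disj AX BX] by simp
  also have "\<dots> = expectation X"
    unfolding set_lebesgue_integral_def
    using X ae by (intro integral_cong_AE) (auto simp: indicator_def elim!: eventually_mono)
  finally have sum: "(\<integral>w\<in>B. X w \<partial>M) = expectation X - (\<integral>w\<in>A. X w \<partial>M)"
    by simp
  have "(\<integral>w\<in>A. (X w - expectation X) \<partial>M) = (\<integral>w\<in>A. X w \<partial>M) - (\<integral>w\<in>A. expectation X \<partial>M)"
    using A by (intro set_integral_diff AX) (auto simp: set_integrable_def emeasure_eq_measure)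
  also have "(\<integral>w\<in>A. expectation X \<partial>M) = expectation X * prob A"
    using A by (simp add: set_lebesgue_integral_def)
  \<comment> \<open>With \<open>a\<close> the integral of \<open>X\<close> over \<open>A\<close>,
    \<open>p = prob A\<close> and \<open>e = expectation X\<close>, the claim is that
    \<open>a / p = (e - a) / (1 - p)\<close> iff \<open>a - e * p = 0\<close>. On cross-multiplying,
    the terms \<open>a * p\<close> cancel; \<open>0 < p < 1\<close> keeps both denominators
    nonzero.\<close>
  finally show ?thesis
    unfolding expectation_given_event_def sum pB using pA by (auto simp: field_simps)
qed

text \<open>Independence turns the joint law of \<open>(V, W)\<close> into the product of the
  marginal laws, so Fubini applies. Both layers are then pulled back to \<open>M\<close>: the outer
  variable \<open>v\<close> acts as an independent copy of the sample point, at which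
  \<open>V\<close> is frozen while \<open>W\<close> is integrated.\<close>

lemma (in prob_space) indep_set_integral_pair:
  fixes V :: "'a \<Rightarrow> 'v" and W :: "'a \<Rightarrow> 'x" and h :: "'x \<Rightarrow> real"
  assumes V [measurable]: "V \<in> measurable M N" and W [measurable]: "W \<in> measurable M L"
    and ind: "indep_set (sets (vimage_algebra (space M) V N)) (sets (vimage_algebra (space M) W L))"
    and S [measurable]: "S \<in> sets (N \<Otimes>\<^sub>M L)"
    and h [measurable]: "h \<in> borel_measurable L" and int: "integrable M (\<lambda>w. h (W w))"
  shows "(\<integral>w\<in>{w \<in> space M. (V w, W w) \<in> S}. h (W w) \<partial>M) =
    (\<integral>v. (\<integral>w\<in>{w \<in> space M. (V v, W w) \<in> S}. h (W w) \<partial>M) \<partial>M)"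
proof -
  interpret PV: prob_space "distr M N V" by (rule prob_space_distr) measurable
  interpret PW: prob_space "distr M L W" by (rule prob_space_distr) measurable
  interpret P: pair_sigma_finite "distr M N V" "distr M L W" ..
  define F where "F = (\<lambda>z. indicat_real S z * h (snd z))"
  have F [measurable]: "F \<in> borel_measurable (N \<Otimes>\<^sub>M L)"
    unfolding F_def by measurable
  \<comment> \<open>A product measure is determined by its values on rectangles, and there the
    equality is exactly the product rule of \<open>indep_set\<close>.\<close>
  have eq: "distr M (N \<Otimes>\<^sub>M L) (\<lambda>w. (V w, W w)) = distr M N V \<Otimes>\<^sub>M distr M L W"
  proof (rule pair_measure_eqI[symmetric])
    fix A B assume A: "A \<in> sets (distr M N V)" and B: "B \<in> sets (distr M L W)"
    then have [measurable]: "A \<in> sets N" "B \<in> sets L"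
      by auto
    have "V -` A \<inter> space M \<in> sets (vimage_algebra (space M) V N)"
      "W -` B \<inter> space M \<in> sets (vimage_algebra (space M) W L)"
      by (auto intro: in_vimage_algebra)
    then have "prob ((V -` A \<inter> space M) \<inter> (W -` B \<inter> space M)) =
        prob (V -` A \<inter> space M) * prob (W -` B \<inter> space M)"
      using ind by (rule indep_setD[rotated])
    moreover have "(\<lambda>w. (V w, W w)) -` (A \<times> B) \<inter> space M =
        (V -` A \<inter> space M) \<inter> (W -` B \<inter> space M)"
      by auto
    ultimately show "emeasure (distr M N V) A * emeasure (distr M L W) B =
        emeasure (distr M (N \<Otimes>\<^sub>M L) (\<lambda>w. (V w, W w))) (A \<times> B)"
      by (simp add: emeasure_distr emeasure_eq_measure ennreal_mult)
  qed (auto intro: PV.sigma_finite_measure PW.sigma_finite_measure)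
  \<comment> \<open>\<open>F (V w, W w)\<close> is dominated by \<open>h (W w)\<close> in absolute
    value, since it differs from it only by an indicator.\<close>
  have "integrable M (\<lambda>w. F (V w, W w))"
    using int unfolding F_def
    by (rule Bochner_Integration.integrable_bound) (auto simp: indicator_def)
  then have FI: "integrable (distr M N V \<Otimes>\<^sub>M distr M L W) F"
    unfolding eq[symmetric] by (subst integrable_distr_eq) measurable
  have "(\<integral>w\<in>{w \<in> space M. (V w, W w) \<in> S}. h (W w) \<partial>M) = (\<integral>w. F (V w, W w) \<partial>M)"
    unfolding set_lebesgue_integral_def F_def
    by (intro Bochner_Integration.integral_cong) (auto simp: indicator_def)
  also have "\<dots> = integral\<^sup>L (distr M N V \<Otimes>\<^sub>M distr M L W) F"
    unfolding eq[symmetric] by (subst integral_distr) measurable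
  also have "\<dots> = (\<integral>v. (\<integral>x. F (v, x) \<partial>distr M L W) \<partial>distr M N V)"
    using P.integral_fst'[OF FI] by simp
  also have "\<dots> = (\<integral>v. (\<integral>x. F (V v, x) \<partial>distr M L W) \<partial>M)"
    by (rule integral_distr) measurable
  also have "\<dots> = (\<integral>v. (\<integral>w. F (V v, W w) \<partial>M) \<partial>M)"
    by (intro Bochner_Integration.integral_cong refl integral_distr) measurable
  also have "\<dots> = (\<integral>v. (\<integral>w\<in>{w \<in> space M. (V v, W w) \<in> S}. h (W w) \<partial>M) \<partial>M)"
    unfolding set_lebesgue_integral_def F_def
    by (intro Bochner_Integration.integral_cong) (auto simp: indicator_def)
  finally show ?thesis .
qed

section \<open>Conditional expectation given a random vector\<close>

lemma subalgebra_rv_sigma: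
  "X \<in> borel_measurable M \<Longrightarrow> subalgebra M (rv_sigma M X)"
  by (auto simp: subalgebra_def rv_sigma_def sets_vimage_algebra2 measurable_sets)

text \<open>The events of \<open>rv_sigma M X\<close> are precisely the preimages of Borel sets
  under \<open>X\<close>. Equality of the integrals of \<open>f\<close> and \<open>g\<close> over
  all of them is the defining property of conditional expectation, and it determines the
  \<open>rv_sigma M X\<close>-measurable function \<open>g\<close> almost surely.\<close>

lemma (in prob_space) real_cond_exp_rv_sigma_eq_iff:
  assumes X [measurable]: "X \<in> borel_measurable M"
    and f: "integrable M f" and g: "integrable M g" "g \<in> borel_measurable (rv_sigma M X)"
  shows "(AE w in M. real_cond_exp M (rv_sigma M X) f w = g w) \<longleftrightarrow>
    (\<forall>B\<in>sets borel. (\<integral>w\<in>{w \<in> space M. X w \<in> B}. (f w - g w) \<partial>M) = 0)"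
proof -
  interpret finite_measure_subalgebra M "rv_sigma M X"
    by unfold_locales (simp add: subalgebra_rv_sigma)
  have sets: "sets (rv_sigma M X) = {{w \<in> space M. X w \<in> B} | B. B \<in> sets borel}"
    by (auto simp: rv_sigma_def sets_vimage_algebra2 vimage_def Int_def conj_commute)
  have "(\<integral>w\<in>A. (f w - g w) \<partial>M) = (\<integral>w\<in>A. f w \<partial>M) - (\<integral>w\<in>A. g w \<partial>M)"
    if "A \<in> sets (rv_sigma M X)" for A
  proof -
    have "A \<in> events"
      using that sets by auto
    then show ?thesis
      by (intro set_integral_diff) (simp_all only: set_integrable_def integrable_mult_indicator f g)
  qed
  then have "(\<forall>B\<in>sets borel. (\<integral>w\<in>{w \<in> space M. X w \<in> B}. (f w - g w) \<partial>M) = 0) \<longleftrightarrow>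
      (\<forall>A\<in>sets (rv_sigma M X). (\<integral>w\<in>A. f w \<partial>M) = (\<integral>w\<in>A. g w \<partial>M))"
    unfolding sets by (smt (verit, ccfv_SIG) mem_Collect_eq)
  moreover have "(\<integral>w\<in>A. f w \<partial>M) = (\<integral>w\<in>A. g w \<partial>M)"
    if "AE w in M. real_cond_exp M (rv_sigma M X) f w = g w" "A \<in> sets (rv_sigma M X)" for A
  proof -
    have "A \<in> events"
      using that sets by auto
    have "(\<integral>w\<in>A. f w \<partial>M) = (\<integral>w\<in>A. real_cond_exp M (rv_sigma M X) f w \<partial>M)"
      using real_cond_exp_intA[OF f that(2)] .
    also have "\<dots> = (\<integral>w\<in>A. g w \<partial>M)"
      unfolding set_lebesgue_integral_def
      using that(1) \<open>A \<in> events\<close> g(1)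
      by (intro integral_cong_AE) (auto elim!: eventually_mono)
    finally show ?thesis .
  qed
  ultimately show ?thesis
    using real_cond_exp_charact[OF _ f g] by blast
qed

section \<open>The equivalence for selection on \<open>\<omega>\<close> and
  \<open>\<nu>\<close>\<close>

theorem corollary3p3:
  fixes M :: "'w measure"
    and \<alpha> :: "'w \<Rightarrow> 'a::euclidean_space"
    and \<epsilon>1 :: "'w \<Rightarrow> 'e1::euclidean_space" and \<epsilon>2 :: "'w \<Rightarrow> 'e2::euclidean_space"
    and \<mu> :: "'w \<Rightarrow> 'm::euclidean_space"
    and \<eta>1 :: "'w \<Rightarrow> 'h1::euclidean_space" and \<eta>2 :: "'w \<Rightarrow> 'h2::euclidean_space"
    and \<nu> :: "'w \<Rightarrow> real"
    and \<xi>1 :: "'a \<times> 'e1 \<Rightarrow> real" and \<xi>2 :: "'a \<times> 'e2 \<Rightarrow> real"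
    and Y1 Y2 :: "'w \<Rightarrow> real"
    and \<omega> :: "'w \<Rightarrow> 'a \<times> 'e1 \<times> 'm \<times> 'h1"
  assumes "prob_space M"
    and "\<alpha> \<in> borel_measurable M"
    and "\<epsilon>1 \<in> borel_measurable M" and "\<epsilon>2 \<in> borel_measurable M"
    and "\<mu> \<in> borel_measurable M"
    and "\<eta>1 \<in> borel_measurable M" and "\<eta>2 \<in> borel_measurable M"
    and "\<nu> \<in> borel_measurable M"
    and "\<xi>1 \<in> borel_measurable borel" and "\<xi>2 \<in> borel_measurable borel"
    and "Y1 = (\<lambda>w. \<xi>1 (\<alpha> w, \<epsilon>1 w))" and "Y2 = (\<lambda>w. \<xi>2 (\<alpha> w, \<epsilon>2 w))"
    and "integrable M Y1" and "integrable M Y2"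
    and "\<omega> = (\<lambda>w. (\<alpha> w, \<epsilon>1 w, \<mu> w, \<eta>1 w))"
    and "\<exists>c::real. measure M {w \<in> space M. \<nu> w > c} \<in> {0<..<1}"
    and "prob_space.indep_set M (sets (rv_sigma M \<nu>))
           (sets (rv_sigma M (\<lambda>w. (\<alpha> w, \<epsilon>1 w, \<epsilon>2 w, \<mu> w, \<eta>1 w, \<eta>2 w))))"
    and "measure M {w \<in> space M.
             real_cond_exp M (rv_sigma M \<omega>) (\<lambda>v. demeaned M Y2 v - demeaned M Y1 v) w > 0} < 1 \<or>
         measure M {w \<in> space M.
             real_cond_exp M (rv_sigma M \<omega>) (\<lambda>v. demeaned M Y2 v - demeaned M Y1 v) w < 0} < 1"
  shows "(\<forall>g \<in> selection_mechanisms M \<omega> \<nu>.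
            measure M {w \<in> space M. g (\<omega> w, \<nu> w) = 1} \<in> {0<..<1} \<longrightarrow>
            parallel_trends M Y1 Y2 (\<lambda>w. g (\<omega> w, \<nu> w))) \<longleftrightarrow>
         (AE w in M. real_cond_exp M (rv_sigma M \<omega>) (demeaned M Y2) w = demeaned M Y1 w)"
proof -
  interpret prob_space M by fact
  note [measurable] = assms(2-10)
  \<comment> \<open>The outcome change involves \<open>\<epsilon>2\<close>, which is no coordinate
    of \<open>\<omega>\<close>. Fubini is therefore applied to the full vector, of which both the
    change and \<open>\<omega>\<close> are functions.\<close>
  define W where "W = (\<lambda>w. (\<alpha> w, \<epsilon>1 w, \<epsilon>2 w, \<mu> w, \<eta>1 w, \<eta>2 w))"
  have W: "W \<in> borel_measurable M"
    unfolding W_def by measurable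
  have \<omega> [measurable]: "\<omega> \<in> borel_measurable M"
    unfolding assms(15) by measurable
  have ind: "indep_set (sets (vimage_algebra (space M) \<nu> borel)) (sets (vimage_algebra (space M) W borel))"
    using assms(17) by (simp add: W_def rv_sigma_def)
  define X where "X = (\<lambda>w. Y2 w - Y1 w)"
  define D where "D = (\<lambda>w. X w - expectation X)"
  have X: "integrable M X"
    unfolding X_def using assms(13,14) by simp
  have D: "integrable M D"
    unfolding D_def using X by simp
  have D_eq: "D = (\<lambda>w. demeaned M Y2 w - demeaned M Y1 w)"
    using assms(13,14) by (auto simp: D_def X_def demeaned_def)
  \<comment> \<open>\<open>?q\<close> drops \<open>\<epsilon>2\<close> and \<open>\<eta>2\<close>,
    turning \<open>W\<close> into \<open>\<omega>\<close>; \<open>h\<close> below recovers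
    \<open>D\<close> from \<open>W\<close>.\<close>
  have proj [measurable]:
    "(\<lambda>x. (fst x, fst (snd x), fst (snd (snd (snd x))), fst (snd (snd (snd (snd x))))))
      \<in> measurable (borel :: ('a \<times> 'e1 \<times> 'e2 \<times> 'm \<times> 'h1 \<times> 'h2) measure)
           (borel :: ('a \<times> 'e1 \<times> 'm \<times> 'h1) measure)" (is "?q \<in> _")
    by (intro borel_measurable_continuous_onI continuous_intros)
  define h where "h = (\<lambda>x::'a \<times> 'e1 \<times> 'e2 \<times> 'm \<times> 'h1 \<times> 'h2.
      \<xi>2 (fst x, fst (snd (snd x))) - \<xi>1 (fst x, fst (snd x)) - expectation X)"
  have h: "h \<in> borel_measurable borel"
  proof -
    have [measurable]: "(\<lambda>x::'a \<times> 'e1 \<times> 'e2 \<times> 'm \<times> 'h1 \<times> 'h2. (fst x, fst (snd (snd x)))) \<in> borel_measurable borel"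
      "(\<lambda>x::'a \<times> 'e1 \<times> 'e2 \<times> 'm \<times> 'h1 \<times> 'h2. (fst x, fst (snd x))) \<in> borel_measurable borel"
      by (auto intro!: borel_measurable_continuous_onI continuous_intros)
    show ?thesis
      unfolding h_def by measurable
  qed
  have hW: "D = (\<lambda>w. h (W w))"
    by (simp add: D_def X_def h_def W_def assms(11,12))
  have qW: "\<omega> = (\<lambda>w. ?q (W w))"
    by (simp add: W_def assms(15))

  have fubini: "(\<integral>w\<in>{w \<in> space M. (\<omega> w, \<nu> w) \<in> S}. D w \<partial>M) =
      (\<integral>v. (\<integral>w\<in>{w \<in> space M. (\<omega> w, \<nu> v) \<in> S}. D w \<partial>M) \<partial>M)"
    if [measurable]: "S \<in> sets borel" for S
  proof -
    have [measurable]: "S \<in> sets (borel \<Otimes>\<^sub>M borel)"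
      using that unfolding borel_prod .
    \<comment> \<open>The general lemma takes pairs in the order \<open>(\<nu>, W)\<close>, so
      \<open>S\<close> is pulled back along the map that swaps the components and applies
      \<open>?q\<close>.\<close>
    have "{z \<in> space (borel \<Otimes>\<^sub>M borel). (?q (snd z), fst z) \<in> S} \<in> sets (borel \<Otimes>\<^sub>M borel)"
      by measurable
    then have "{z. (?q (snd z), fst z) \<in> S} \<in> sets (borel \<Otimes>\<^sub>M borel)"
      by (simp add: space_pair_measure)
    from indep_set_integral_pair[OF assms(8) W ind this h] show ?thesis
      using D by (simp add: hW qW)
  qed

  have trends: "parallel_trends M Y1 Y2 (\<lambda>w. g (\<omega> w, \<nu> w)) \<longleftrightarrow>
      (\<integral>w\<in>{w \<in> space M. g (\<omega> w, \<nu> w) = 1}. D w \<partial>M) = 0"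
    if g: "g \<in> selection_mechanisms M \<omega> \<nu>"
      and p: "measure M {w \<in> space M. g (\<omega> w, \<nu> w) = 1} \<in> {0<..<1}" for g
    unfolding parallel_trends_def D_def X_def[symmetric]
  proof (rule expectation_given_event_eq_iff[OF X _ _ _ _ p])
    have [measurable]: "g \<in> measurable borel (count_space UNIV)"
      using g by (rule selection_mechanism_measurable)
    show "{w \<in> space M. g (\<omega> w, \<nu> w) = 1} \<in> events" "{w \<in> space M. g (\<omega> w, \<nu> w) = 0} \<in> events"
      by measurable
    have g01: "g (x, v) \<in> {0, 1}" if "x \<in> rv_support M \<omega>" "v \<in> rv_support M \<nu>" for x v
      using g that by (auto simp: selection_mechanisms_def measurable_def space_restrict_space)
    \<comment> \<open>The two groups exhaust the space only almost surely: \<open>g\<close> is known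
      to be 0 or 1 only on the product of the supports.\<close>
    show "AE w in M. w \<in> {w \<in> space M. g (\<omega> w, \<nu> w) = 1} \<union> {w \<in> space M. g (\<omega> w, \<nu> w) = 0}"
      using AE_in_rv_support[OF \<omega>] AE_in_rv_support[OF assms(8)] AE_space
      by eventually_elim (use g01 in blast)
  qed auto

  \<comment> \<open>\<open>Y1\<close> depends on \<open>\<alpha>\<close> and
    \<open>\<epsilon>1\<close> alone, both coordinates of \<open>\<omega>\<close>. The condition in
    the theorem can thus be tested through integrals of \<open>D\<close> over events of the form
    \<open>\<omega> w \<in> B\<close>.\<close>
  have Y1: "demeaned M Y1 \<in> borel_measurable (rv_sigma M \<omega>)"
  proof -
    have \<omega>': "\<omega> \<in> borel_measurable (rv_sigma M \<omega>)"
      unfolding rv_sigma_def by (rule measurable_vimage_algebra1) auto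
    have [measurable]: "(\<lambda>x. (fst x, fst (snd x))) \<in> measurable (borel :: ('a \<times> 'e1 \<times> 'm \<times> 'h1) measure) borel"
      by (intro borel_measurable_continuous_onI continuous_intros)
    have "(\<lambda>x. \<xi>1 (fst x, fst (snd x)) - expectation Y1)
        \<in> borel_measurable (borel :: ('a \<times> 'e1 \<times> 'm \<times> 'h1) measure)"
      by measurable
    from measurable_compose[OF \<omega>' this] show ?thesis
      by (simp add: demeaned_def assms(11,15))
  qed
  have cond: "(AE w in M. real_cond_exp M (rv_sigma M \<omega>) (demeaned M Y2) w = demeaned M Y1 w) \<longleftrightarrow>
      (\<forall>B\<in>sets borel. (\<integral>w\<in>{w \<in> space M. \<omega> w \<in> B}. D w \<partial>M) = 0)"
    unfolding D_eq using assms(13,14)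
    by (intro real_cond_exp_rv_sigma_eq_iff \<omega> Y1) (auto simp: demeaned_def)

  show ?thesis
    unfolding cond
  proof (intro iffI ballI impI)
    fix B :: "('a \<times> 'e1 \<times> 'm \<times> 'h1) set"
    assume all: "\<forall>g \<in> selection_mechanisms M \<omega> \<nu>.
        measure M {w \<in> space M. g (\<omega> w, \<nu> w) = 1} \<in> {0<..<1} \<longrightarrow>
        parallel_trends M Y1 Y2 (\<lambda>w. g (\<omega> w, \<nu> w))"
      and B [measurable]: "B \<in> sets borel"
    obtain c where c: "prob {w \<in> space M. \<nu> w > c} \<in> {0<..<1}"
      using assms(16) by blast
    define S where "S = B \<times> {c<..}"
    have S [measurable]: "S \<in> sets borel"
    proof -
      have "B \<times> {c<..} \<in> sets (borel \<Otimes>\<^sub>M borel)"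
        using B by (intro pair_measureI) auto
      then show ?thesis
        unfolding S_def borel_prod .
    qed
    define A where "A = {w \<in> space M. (\<omega> w, \<nu> w) \<in> S}"
    define I where "I = (\<integral>w\<in>{w \<in> space M. \<omega> w \<in> B}. D w \<partial>M)"
    have A [measurable]: "A \<in> events"
      unfolding A_def by measurable
    define g :: "_ \<Rightarrow> nat" where "g = restrict (indicator S) (rv_support M \<omega> \<times> rv_support M \<nu>)"
    have g: "g \<in> selection_mechanisms M \<omega> \<nu>"
      unfolding g_def using S by (rule restrict_indicator_selection_mechanism)
    have [measurable]: "g \<in> measurable borel (count_space UNIV)"
      using g by (rule selection_mechanism_measurable)
    \<comment> \<open>\<open>g\<close> agrees with the indicator of \<open>S\<close> on the supports
      only, so its treated group and \<open>A\<close> coincide up to a null set; this is enough for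
      probabilities and integrals.\<close>
    have ae: "AE w in M. w \<in> {w \<in> space M. g (\<omega> w, \<nu> w) = 1} \<longleftrightarrow> w \<in> A"
      using AE_in_rv_support[OF \<omega>] AE_in_rv_support[OF assms(8)] AE_space
      by eventually_elim (auto simp: g_def A_def indicator_def)
    have prob_eq: "prob {w \<in> space M. g (\<omega> w, \<nu> w) = 1} = prob A"
      by (rule finite_measure_eq_AE[OF ae]) measurable
    have int_eq: "(\<integral>w\<in>{w \<in> space M. g (\<omega> w, \<nu> w) = 1}. D w \<partial>M) = (\<integral>w\<in>A. D w \<partial>M)"
      unfolding set_lebesgue_integral_def using ae D
      by (intro integral_cong_AE) (auto simp: indicator_def elim!: eventually_mono)
    have "(\<integral>w\<in>A. D w \<partial>M) = 0"
    \<comment> \<open>If \<open>A\<close> is null, parallel trends says nothing about this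
      mechanism, but the integral vanishes anyway. Otherwise the bound by the probability of
      \<open>\<nu> > c\<close> puts \<open>prob A\<close> strictly between 0 and 1.\<close>
    proof (cases "prob A = 0")
      case True
      then have "AE w in M. w \<notin> A"
        using A by (simp add: prob_eq_0)
      then have "(\<integral>w\<in>A. D w \<partial>M) = (\<integral>w. 0 \<partial>M)"
        unfolding set_lebesgue_integral_def using D
        by (intro integral_cong_AE) (auto simp: indicator_def elim!: eventually_mono)
      then show ?thesis
        by simp
    next
      case False
      have "prob A \<le> prob {w \<in> space M. \<nu> w > c}"
        by (intro finite_measure_mono) (auto simp: A_def S_def)
      with False c have "prob A \<in> {0<..<1}"
        by (auto simp: zero_less_measure_iff)
      then show ?thesis
        using all[rule_format, OF g] trends[OF g] unfolding prob_eq int_eq by blast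
    qed
    moreover have "(\<integral>w\<in>A. D w \<partial>M) =
        (\<integral>v. (\<integral>w\<in>{w \<in> space M. (\<omega> w, \<nu> v) \<in> S}. D w \<partial>M) \<partial>M)"
      unfolding A_def by (rule fubini[OF S])
    \<comment> \<open>The section of \<open>S\<close> at \<open>\<nu> v\<close> is \<open>B\<close>
      when \<open>\<nu> v > c\<close> and empty otherwise, so the inner integral is \<open>I\<close>
      or 0. Since \<open>\<nu> > c\<close> has positive probability, \<open>I\<close> itself must
      vanish.\<close>
    moreover have "\<dots> = (\<integral>v. indicator {w \<in> space M. \<nu> w > c} v * I \<partial>M)"
      unfolding I_def S_def
      by (intro Bochner_Integration.integral_cong) (auto simp: indicator_def set_lebesgue_integral_def)
    moreover have "\<dots> = prob {w \<in> space M. \<nu> w > c} * I"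
      by simp
    ultimately show "(\<integral>w\<in>{w \<in> space M. \<omega> w \<in> B}. D w \<partial>M) = 0"
      using c by (simp add: I_def)
  next
    fix g
    assume zero: "\<forall>B\<in>sets borel. (\<integral>w\<in>{w \<in> space M. \<omega> w \<in> B}. D w \<partial>M) = 0"
      and g: "g \<in> selection_mechanisms M \<omega> \<nu>"
      and p: "measure M {w \<in> space M. g (\<omega> w, \<nu> w) = 1} \<in> {0<..<1}"
    have [measurable]: "g \<in> measurable borel (count_space UNIV)"
      using g by (rule selection_mechanism_measurable)
    define S where "S = {z. g z = 1}"
    have S: "S \<in> sets borel"
    proof -
      have "{z \<in> space borel. g z = 1} \<in> sets borel"
        by measurable
      then show ?thesis
        by (simp add: S_def)
    qed
    \<comment> \<open>With the second component frozen at \<open>v\<close>, the event says that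
      \<open>\<omega>\<close> lies in a Borel section of \<open>S\<close>, to which the assumption
      \<open>zero\<close> applies.\<close>
    have inner: "(\<integral>w\<in>{w \<in> space M. (\<omega> w, v) \<in> S}. D w \<partial>M) = 0" for v
    proof -
      have "(\<lambda>x. (x, v)) -` S \<inter> space borel \<in> sets borel"
        using S by (intro measurable_sets[of _ borel borel]) auto
      then show ?thesis
        using zero by force
    qed
    have "(\<integral>w\<in>{w \<in> space M. (\<omega> w, \<nu> w) \<in> S}. D w \<partial>M) = 0"
      using fubini[OF S] by (simp add: inner)
    then show "parallel_trends M Y1 Y2 (\<lambda>w. g (\<omega> w, \<nu> w))"
      using trends[OF g p] by (simp add: S_def)
  qed
qed

end
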